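(* Both sets of Lax equations (of the AKNS hierarchy and of the strict AKNS hierarchy) are compatible systems, in the following sense. If $(R,\{\partial_m\mid m\geq0\})$ is a setting for the AKNS hierarchy and $Q$ is a solution of the AKNS hierarchy, then the projections $B_m:=(Qz^m)_{\geq0}$, $m\geq0$, satisfy the zero curvature relations $$\partial_{m_1}(B_{m_2})-\partial_{m_2}(B_{m_1})-[B_{m_1},B_{m_2}]=0\quad\text{for all }m_1,m_2\geq0.$$ If $(R,\{\partial_m\mid m\geq1\})$ is a setting for the strict AKNS hierarchy and $Z$ is a solution of the strict AKNS hierarchy, then the projections $C_m:=(Zz^{m-1})_{>0}$, $m\geq1$, satisfy the zero curvature relations $$\partial_{m_1}(C_{m_2})-\partial_{m_2}(C_{m_1})-[C_{m_1},C_{m_2}]=0\quad\text{for all }m_1,m_2\geq1.$$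
   Context: A setting for the AKNS (resp. strict AKNS) hierarchy is a commutative complex algebra $R$ together with a set of commuting $\mathbb{C}$-linear derivations $\partial_m:R\to R$, $m\geq0$ (resp. $m\geq1$). $\mathrm{gl}_2(R)[z,z^{-1})$ is the algebra of series $X=\sum_{i=-\infty}^NX_iz^i$ with $X_i\in\mathrm{gl}_2(R)$, $N\in\mathbb{Z}$, with bracket $[X,Y]=\sum_{i,j}[X_i,Y_j]z^{i+j}$; each $\partial_m$ acts on it coefficientwise. Put $(X)_{\geq0}=\sum_{i\geq0}X_iz^i$ and $(X)_{>0}=\sum_{i\geq1}X_iz^i$. Let $Q_0=\begin{pmatrix}-i&0\\0&i\end{pmatrix}$, $G_{<0}=\{\mathrm{Id}+\sum_{j\geq1}Y_jz^{-j}\mid Y_j\in\mathrm{gl}_2(R)\}$, and let $\mathrm{gl}_2(R)^*$ be the invertible elements of $\mathrm{gl}_2(R)$. A solution of the AKNS hierarchy is an element $Q=gQ_0g^{-1}$ with $g\in G_{<0}$ satisfying the Lax equations $\partial_m(Q)=[(Qz^m)_{\geq0},Q]$ for all $m\geq0$. A solution of the strict AKNS hierarchy is an element $Z=KgQ_0z\,g^{-1}K^{-1}$ with $K\in\mathrm{gl}_2(R)^*$, $g\in G_{<0}$, satisfying the Lax equations $\partial_m(Z)=[(Zz^{m-1})_{>0},Z]$ for all $m\geq1$. *)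

theory Defs
  imports "HOL-Analysis.Analysis" "HOL-Computational_Algebra.Formal_Laurent_Series"
begin

section \<open>The ring of 2x2 matrices\<close>

text \<open>
  The instance \<open>times\<close> of the library type \<open>'a^2^2\<close> is the entrywise product; the wrapper type
  below carries the matrix product instead, so that Laurent series over it multiply correctly.
\<close>

typedef 'a gl2 = "UNIV :: ('a^2^2) set"
  morphisms matrix_of_gl2 gl2_of_matrix ..

setup_lifting type_definition_gl2

instantiation gl2 :: (comm_ring_1) ring_1
begin
lift_definition zero_gl2 :: "'a gl2" is 0 .
lift_definition one_gl2 :: "'a gl2" is "mat 1" .
lift_definition plus_gl2 :: "'a gl2 \<Rightarrow> 'a gl2 \<Rightarrow> 'a gl2" is "(+)" .
lift_definition minus_gl2 :: "'a gl2 \<Rightarrow> 'a gl2 \<Rightarrow> 'a gl2" is "(-)" .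
lift_definition uminus_gl2 :: "'a gl2 \<Rightarrow> 'a gl2" is uminus .
lift_definition times_gl2 :: "'a gl2 \<Rightarrow> 'a gl2 \<Rightarrow> 'a gl2" is "(**)" .
instance
proof
  fix a b c :: "'a gl2"
  show "a * b * c = a * (b * c)"
    by transfer (simp add: matrix_mul_assoc)
  show "1 * a = a" "a * 1 = a"
    by (transfer, simp)+
  show "a + b + c = a + (b + c)" "a + b = b + a" "0 + a = a" "- a + a = 0" "a - b = a + - b"
    by (transfer, simp add: add_ac)+
  show "(a + b) * c = a * c + b * c"
    by transfer (vector matrix_matrix_mult_def sum.distrib distrib_right)
  show "a * (b + c) = a * b + a * c"
    by transfer (simp add: matrix_add_ldistrib)
  show "(0 :: 'a gl2) \<noteq> 1"
    by transfer (simp add: mat_def vec_eq_iff exI[of _ "1 :: 2"])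
qed
end

lift_definition map_gl2 :: "('a \<Rightarrow> 'b) \<Rightarrow> 'a gl2 \<Rightarrow> 'b gl2"
  is map_matrix .

lift_definition gl2_entries :: "'a::zero \<Rightarrow> 'a \<Rightarrow> 'a \<Rightarrow> 'a \<Rightarrow> 'a gl2"
  is "\<lambda>a b c d. vector [vector [a, b], vector [c, d]]" .

definition inverse_pair :: "'a::monoid_mult \<Rightarrow> 'a \<Rightarrow> bool"
  where "inverse_pair x y \<longleftrightarrow> x * y = 1 \<and> y * x = 1"

lemma inverse_pair_unique: "inverse_pair x y \<Longrightarrow> inverse_pair x y' \<Longrightarrow> y = y'"
  unfolding inverse_pair_def by (metis mult.assoc mult_1_left mult_1_right)


section \<open>Series in \<open>z\<close>, unbounded in the negative direction\<close>

text \<open>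
  The algebra \<open>gl\<^sub>2(R)[z,z\<^sup>-\<^sup>1)\<close> is the ring of formal Laurent series in the variable \<open>z\<^sup>-\<^sup>1\<close>: the
  library variable \<open>fls_X\<close> plays the role of \<open>z\<^sup>-\<^sup>1\<close>, so the coefficient of \<open>z\<^sup>i\<close> is the
  coefficient of \<open>fls_X\<close> to the power \<open>- i\<close>.
\<close>

type_synonym 'r gl2_series = "'r gl2 fls"

definition zcoeff :: "'a::zero fls \<Rightarrow> int \<Rightarrow> 'a"
  where "zcoeff X i = fls_nth X (- i)"

abbreviation z_var :: "'a::{zero,one} fls"
  where "z_var \<equiv> fls_X_inv"

text \<open>\<open>series_ge k X\<close> is the sum of the terms \<open>X\<^sub>i z\<^sup>i\<close> with \<open>i \<ge> k\<close>.\<close>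

lift_definition series_ge :: "int \<Rightarrow> 'a::zero fls \<Rightarrow> 'a fls"
  is "\<lambda>k X n. if k \<le> - n then X n else 0"
  by (auto elim: MOST_mono)

abbreviation nonneg_part :: "'a::zero fls \<Rightarrow> 'a fls"
  where "nonneg_part X \<equiv> series_ge 0 X"

abbreviation pos_part :: "'a::zero fls \<Rightarrow> 'a fls"
  where "pos_part X \<equiv> series_ge 1 X"

text \<open>
  By the Cauchy product this commutator is the sum of \<open>[X\<^sub>i, Y\<^sub>j] z\<^sup>i\<^sup>+\<^sup>j\<close> over all \<open>i\<close> and \<open>j\<close>.
\<close>

definition bracket :: "'a::ring fls \<Rightarrow> 'a fls \<Rightarrow> 'a fls"
  where "bracket X Y = X * Y - Y * X"

definition coeffwise :: "('r \<Rightarrow> 'r) \<Rightarrow> 'r::comm_ring_1 gl2_series \<Rightarrow> 'r gl2_series"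
  where "coeffwise D X = Abs_fls (\<lambda>n. map_gl2 D (fls_nth X n))"

text \<open>
  The side condition holds for every additive \<open>D\<close>; it makes the right-hand side of
  \<open>coeffwise\<close> a series that is bounded above in \<open>z\<close>.
\<close>

lemma zcoeff_coeffwise:
  assumes "D 0 = 0"
  shows "zcoeff (coeffwise D X) i = map_gl2 D (zcoeff X i)"
proof -
  have "map_gl2 D 0 = 0"
    using assms by transfer (simp add: vec_eq_iff)
  then have "\<forall>\<^sub>\<infinity>n. map_gl2 D (fls_nth X (- int n)) = 0"
    by (intro MOST_mono[OF MOST_fls_neg_nth_eq_0[of X]]) simp
  then show ?thesis
    by (simp add: coeffwise_def zcoeff_def)
qed

lemma zcoeff_series_ge: "zcoeff (series_ge k X) i = (if k \<le> i then zcoeff X i else 0)"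
  unfolding zcoeff_def by transfer simp

lemma zcoeff_bracket_monomials:
  fixes A B :: "'a::ring_1"
  shows "zcoeff (bracket (fls_shift i (fls_const A)) (fls_shift j (fls_const B))) k
    = (if k = i + j then A * B - B * A else 0)"
  by (auto simp: zcoeff_def bracket_def fls_shifted_times_simps)

definition G_neg :: "'r::comm_ring_1 gl2_series set"
  where "G_neg = {g. zcoeff g 0 = 1 \<and> (\<forall>i>0. zcoeff g i = 0)}"

lemma G_neg_invertible:
  assumes "g \<in> G_neg"
  shows "\<exists>h. inverse_pair g h"
proof -
  have g: "fls_nth g 0 = 1" "\<And>n. n < 0 \<Longrightarrow> fls_nth g n = 0"
    using assms by (auto simp: G_neg_def zcoeff_def) (metis minus_minus neg_0_less_iff_less)
  then have "fls_subdegree g = 0"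
    by (intro fls_subdegree_eqI) auto
  then have "fls_nth g (fls_subdegree g) = 1"
    using g by simp
  then have unit: "1 * fls_nth g (fls_subdegree g) = 1" "fls_nth g (fls_subdegree g) * 1 = 1"
    by simp_all
  have "g * fls_right_inverse g 1 = 1"
    by (rule fls_right_inverse[OF unit(2)])
  moreover have "fls_right_inverse g 1 * g = 1"
    using fls_left_inverse[OF unit(1)] fls_left_inverse_eq_fls_right_inverse[OF unit] by (simp only:)
  ultimately have "inverse_pair g (fls_right_inverse g 1)"
    by (simp only: inverse_pair_def)
  then show ?thesis ..
qed


section \<open>Settings and solutions\<close>

locale commutative_complex_algebra = vector_space smul
  for smul :: "complex \<Rightarrow> 'r::comm_ring_1 \<Rightarrow> 'r" +
  assumes smul_mult: "smul c (x * y) = smul c x * y"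

definition derivation :: "(complex \<Rightarrow> 'r::comm_ring_1 \<Rightarrow> 'r) \<Rightarrow> ('r \<Rightarrow> 'r) \<Rightarrow> bool"
  where "derivation smul D \<longleftrightarrow>
    Vector_Spaces.linear smul smul D \<and> (\<forall>x y. D (x * y) = D x * y + x * D y)"

definition commuting_derivations ::
  "nat set \<Rightarrow> (complex \<Rightarrow> 'r::comm_ring_1 \<Rightarrow> 'r) \<Rightarrow> (nat \<Rightarrow> 'r \<Rightarrow> 'r) \<Rightarrow> bool"
  where "commuting_derivations I smul del \<longleftrightarrow>
    (\<forall>m\<in>I. derivation smul (del m)) \<and> (\<forall>m\<in>I. \<forall>n\<in>I. \<forall>x. del m (del n x) = del n (del m x))"

definition AKNS_setting ::
  "(complex \<Rightarrow> 'r::comm_ring_1 \<Rightarrow> 'r) \<Rightarrow> (nat \<Rightarrow> 'r \<Rightarrow> 'r) \<Rightarrow> bool"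
  where "AKNS_setting smul del \<longleftrightarrow>
    commutative_complex_algebra smul \<and> commuting_derivations {0..} smul del"

text \<open>In the strict case the value \<open>del 0\<close> is unconstrained and never used.\<close>

definition strict_AKNS_setting ::
  "(complex \<Rightarrow> 'r::comm_ring_1 \<Rightarrow> 'r) \<Rightarrow> (nat \<Rightarrow> 'r \<Rightarrow> 'r) \<Rightarrow> bool"
  where "strict_AKNS_setting smul del \<longleftrightarrow>
    commutative_complex_algebra smul \<and> commuting_derivations {1..} smul del"

definition Q\<^sub>0 :: "(complex \<Rightarrow> 'r::comm_ring_1 \<Rightarrow> 'r) \<Rightarrow> 'r gl2"
  where "Q\<^sub>0 smul = gl2_entries (smul (- \<i>) 1) 0 0 (smul \<i> 1)"

definition AKNS_projection :: "'r::comm_ring_1 gl2_series \<Rightarrow> nat \<Rightarrow> 'r gl2_series"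
  where "AKNS_projection Q m = nonneg_part (Q * z_var ^ m)"

definition strict_AKNS_projection :: "'r::comm_ring_1 gl2_series \<Rightarrow> nat \<Rightarrow> 'r gl2_series"
  where "strict_AKNS_projection Z m = pos_part (Z * z_var ^ (m - 1))"

definition AKNS_solution ::
  "(complex \<Rightarrow> 'r::comm_ring_1 \<Rightarrow> 'r) \<Rightarrow> (nat \<Rightarrow> 'r \<Rightarrow> 'r) \<Rightarrow> 'r gl2_series \<Rightarrow> bool"
  where "AKNS_solution smul del Q \<longleftrightarrow>
    (\<exists>g\<in>G_neg. \<exists>g'. inverse_pair g g' \<and> Q = g * fls_const (Q\<^sub>0 smul) * g') \<and>
    (\<forall>m. coeffwise (del m) Q = bracket (AKNS_projection Q m) Q)"

definition strict_AKNS_solution ::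
  "(complex \<Rightarrow> 'r::comm_ring_1 \<Rightarrow> 'r) \<Rightarrow> (nat \<Rightarrow> 'r \<Rightarrow> 'r) \<Rightarrow> 'r gl2_series \<Rightarrow> bool"
  where "strict_AKNS_solution smul del Z \<longleftrightarrow>
    (\<exists>K K'. inverse_pair K K' \<and> (\<exists>g\<in>G_neg. \<exists>g'. inverse_pair g g' \<and>
      Z = fls_const K * g * fls_const (Q\<^sub>0 smul) * z_var * g' * fls_const K')) \<and>
    (\<forall>m\<ge>1. coeffwise (del m) Z = bracket (strict_AKNS_projection Z m) Z)"

end

theory Submission
  imports Defs
begin

text \<open>
  Put \<open>L\<^sub>m = L z\<^sup>m\<close>, let \<open>B\<^sub>m\<close> be its part of degree at least \<open>k\<close>, and \<open>A\<^sub>m = B\<^sub>m - L\<^sub>m\<close>. As \<open>L\<^sub>m\<close> and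
  \<open>L\<^sub>n\<close> commute, \<open>[B\<^sub>m, L\<^sub>n] - [B\<^sub>n, L\<^sub>m] = [B\<^sub>m, B\<^sub>n] - [A\<^sub>m, A\<^sub>n]\<close>. By the Lax equations the part of
  degree at least \<open>k\<close> of the left-hand side is \<open>\<partial>\<^sub>m B\<^sub>n - \<partial>\<^sub>n B\<^sub>m\<close>. For \<open>k \<in> {0, 1}\<close> the brackets of
  series of degree at least \<open>k\<close> (resp. less than \<open>k\<close>) are again of that kind, so the same part of the
  right-hand side is \<open>[B\<^sub>m, B\<^sub>n]\<close>.
\<close>

lemma zcoeff_eqI: "(\<And>i. zcoeff X i = zcoeff Y i) \<Longrightarrow> X = Y"
  unfolding zcoeff_def by (metis fls_eq_iff minus_minus)

lemma zcoeff_diff: "zcoeff (X - Y) i = zcoeff X i - zcoeff Y i"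
  for X :: "'a::group_add fls"
  by (simp add: zcoeff_def)

lemma zcoeff_times_eq_0:
  fixes X Y :: "'a::semiring_0 fls"
  assumes "\<And>i j. i + j = n \<Longrightarrow> zcoeff X i * zcoeff Y j = 0"
  shows "zcoeff (X * Y) n = 0"
proof -
  \<comment> \<open>\<open>fls_nth\<close> is indexed by minus the degree in \<open>z_var\<close>,
    so these factors have degrees \<open>- i\<close> and \<open>n + i\<close>.\<close>
  have "fls_nth X i * fls_nth Y (- n - i) = 0" for i
    using assms[of "- i" "n + i"] by (simp add: zcoeff_def)
  then show ?thesis
    by (simp add: zcoeff_def fls_times_nth(2))
qed

text \<open>Products of terms of degree at least \<open>k\<close> have degree at least
  \<open>2 * k\<close>, which is at least \<open>k\<close> because \<open>0 \<le> k\<close>.\<close>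

lemma zcoeff_bracket_ge:
  fixes X Y :: "'a::ring fls"
  assumes "\<And>i. i < k \<Longrightarrow> zcoeff X i = 0" "\<And>i. i < k \<Longrightarrow> zcoeff Y i = 0" "0 \<le> k" "i < k"
  shows "zcoeff (bracket X Y) i = 0"
proof -
  have low: "a < k \<or> b < k" if "a + b = i" for a b
    using that assms(3,4) by linarith
  have "zcoeff (X * Y) i = 0" "zcoeff (Y * X) i = 0"
    using low assms(1,2) by (metis zcoeff_times_eq_0 mult_zero_left mult_zero_right)+
  then show ?thesis
    by (simp add: bracket_def zcoeff_diff)
qed

text \<open>Here degrees are at most \<open>k - 1\<close>, so products have degree at most
  \<open>2 * k - 2\<close>, which is below \<open>k\<close> because
  \<open>k \<le> 1\<close>.\<close>

lemma zcoeff_bracket_lt: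
  fixes X Y :: "'a::ring fls"
  assumes "\<And>i. k \<le> i \<Longrightarrow> zcoeff X i = 0" "\<And>i. k \<le> i \<Longrightarrow> zcoeff Y i = 0" "k \<le> 1" "k \<le> i"
  shows "zcoeff (bracket X Y) i = 0"
proof -
  have high: "k \<le> a \<or> k \<le> b" if "a + b = i" for a b
    using that assms(3,4) by linarith
  have "zcoeff (X * Y) i = 0" "zcoeff (Y * X) i = 0"
    using high assms(1,2) by (metis zcoeff_times_eq_0 mult_zero_left mult_zero_right)+
  then show ?thesis
    by (simp add: bracket_def zcoeff_diff)
qed

lemma series_ge_diff: "series_ge k (X - Y) = series_ge k X - series_ge k Y"
  for X :: "'a::group_add fls"
  by (rule zcoeff_eqI) (simp add: zcoeff_series_ge zcoeff_diff)

lemma map_gl2_0: "D 0 = 0 \<Longrightarrow> map_gl2 D 0 = 0"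
  by transfer (simp add: vec_eq_iff)

lemma coeffwise_series_ge:
  "D 0 = 0 \<Longrightarrow> coeffwise D (series_ge k X) = series_ge k (coeffwise D X)"
  by (rule zcoeff_eqI) (simp add: zcoeff_coeffwise zcoeff_series_ge map_gl2_0)

lemma zcoeff_times_z_var_power: "zcoeff (X * z_var ^ m) i = zcoeff X (i - int m)"
  for X :: "'a::ring_1 fls"
  by (simp add: zcoeff_def fls_X_inv_power_times_conv_shift)

lemma coeffwise_times_z_var_power:
  "D 0 = 0 \<Longrightarrow> coeffwise D (X * z_var ^ m) = coeffwise D X * z_var ^ m"
  by (rule zcoeff_eqI) (simp add: zcoeff_coeffwise zcoeff_times_z_var_power)

text \<open>Multiplication on either side is the same index shift, so \<open>z_var\<close> is
  central even over noncommuting coefficients.\<close>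

lemma z_var_power_commute: "z_var ^ m * X = X * z_var ^ m"
  for X :: "'a::ring_1 fls"
  by (simp add: fls_X_inv_power_times_conv_shift)

text \<open>This carries a Lax equation for \<open>L\<close> over to every
  \<open>L * z_var ^ n\<close>.\<close>

lemma bracket_times_z_var_power: "bracket X (Y * z_var ^ m) = bracket X Y * z_var ^ m"
  for X Y :: "'a::ring_1 fls"
  by (simp add: bracket_def left_diff_distrib mult.assoc z_var_power_commute)

lemma bracket_times_z_var_powers: "bracket (X * z_var ^ m) (X * z_var ^ n) = 0"
  for X :: "'a::ring_1 fls"
proof -
  have "X * z_var ^ a * (X * z_var ^ b) = X * X * z_var ^ (a + b)" for a b
    by (metis mult.assoc power_add z_var_power_commute)
  then show ?thesis
    by (simp add: bracket_def add.commute)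
qed

lemma bracket_splitting:
  fixes B\<^sub>1 B\<^sub>2 L\<^sub>1 L\<^sub>2 :: "'a::ring fls"
  assumes "bracket L\<^sub>1 L\<^sub>2 = 0"
  shows "bracket B\<^sub>1 L\<^sub>2 - bracket B\<^sub>2 L\<^sub>1 = bracket B\<^sub>1 B\<^sub>2 - bracket (B\<^sub>1 - L\<^sub>1) (B\<^sub>2 - L\<^sub>2)"
  using assms by (simp add: bracket_def algebra_simps)

text \<open>Treats both hierarchies at once: \<open>k = 0\<close> is the AKNS case and
  \<open>k = 1\<close> the strict one.\<close>

lemma zero_curvature:
  fixes L :: "'r::comm_ring_1 gl2_series"
  assumes k: "0 \<le> k" "k \<le> 1"
    and D: "D\<^sub>1 0 = 0" "D\<^sub>2 0 = 0"
    and B: "B\<^sub>1 = series_ge k (L * z_var ^ m)" "B\<^sub>2 = series_ge k (L * z_var ^ n)"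
    and Lax: "coeffwise D\<^sub>1 L = bracket B\<^sub>1 L" "coeffwise D\<^sub>2 L = bracket B\<^sub>2 L"
  shows "coeffwise D\<^sub>1 B\<^sub>2 - coeffwise D\<^sub>2 B\<^sub>1 - bracket B\<^sub>1 B\<^sub>2 = 0"
proof -
  define L\<^sub>1 where "L\<^sub>1 = L * z_var ^ m"
  define L\<^sub>2 where "L\<^sub>2 = L * z_var ^ n"
  have B': "B\<^sub>1 = series_ge k L\<^sub>1" "B\<^sub>2 = series_ge k L\<^sub>2"
    by (simp_all add: B L\<^sub>1_def L\<^sub>2_def)
  have "coeffwise D\<^sub>1 L\<^sub>2 = bracket B\<^sub>1 L\<^sub>2" "coeffwise D\<^sub>2 L\<^sub>1 = bracket B\<^sub>2 L\<^sub>1"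
    by (simp_all only: L\<^sub>1_def L\<^sub>2_def coeffwise_times_z_var_power D Lax bracket_times_z_var_power)
  then have "coeffwise D\<^sub>1 B\<^sub>2 = series_ge k (bracket B\<^sub>1 L\<^sub>2)"
      "coeffwise D\<^sub>2 B\<^sub>1 = series_ge k (bracket B\<^sub>2 L\<^sub>1)"
    by (metis B' coeffwise_series_ge D)+
  then have "coeffwise D\<^sub>1 B\<^sub>2 - coeffwise D\<^sub>2 B\<^sub>1 = series_ge k (bracket B\<^sub>1 L\<^sub>2 - bracket B\<^sub>2 L\<^sub>1)"
    by (simp only: series_ge_diff)
  also have "bracket B\<^sub>1 L\<^sub>2 - bracket B\<^sub>2 L\<^sub>1
      = bracket B\<^sub>1 B\<^sub>2 - bracket (B\<^sub>1 - L\<^sub>1) (B\<^sub>2 - L\<^sub>2)"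
    by (rule bracket_splitting) (simp add: L\<^sub>1_def L\<^sub>2_def bracket_times_z_var_powers)
  also have "series_ge k \<dots> = bracket B\<^sub>1 B\<^sub>2"
  proof (rule zcoeff_eqI)
    fix i
    have "zcoeff (bracket B\<^sub>1 B\<^sub>2) i = 0" if "i < k"
      using that k by (intro zcoeff_bracket_ge[of k]) (auto simp: B' zcoeff_series_ge)
    \<comment> \<open>Each difference is minus the part of degree below \<open>k\<close> that the
      truncation removed.\<close>
    moreover have "zcoeff (bracket (B\<^sub>1 - L\<^sub>1) (B\<^sub>2 - L\<^sub>2)) i = 0" if "k \<le> i"
      using that k by (intro zcoeff_bracket_lt[of k]) (auto simp: B' zcoeff_series_ge zcoeff_diff)
    ultimately show "zcoeff (series_ge k (bracket B\<^sub>1 B\<^sub>2 - bracket (B\<^sub>1 - L\<^sub>1) (B\<^sub>2 - L\<^sub>2))) i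
        = zcoeff (bracket B\<^sub>1 B\<^sub>2) i"
      by (simp add: zcoeff_series_ge zcoeff_diff)
  qed
  finally show ?thesis
    by simp
qed

text \<open>The Leibniz rule for a product with 0 forces this; it is the side condition of
  \<open>zcoeff_coeffwise\<close>.\<close>

lemma commuting_derivations_0: "commuting_derivations I smul del \<Longrightarrow> m \<in> I \<Longrightarrow> del m 0 = 0"
  unfolding commuting_derivations_def derivation_def
  by (metis add_cancel_right_right mult_zero_left mult_zero_right)

theorem proposition2p3:
  shows
   "(\<forall>(smul :: complex \<Rightarrow> 'r::comm_ring_1 \<Rightarrow> 'r) del Q.
       AKNS_setting smul del \<longrightarrow> AKNS_solution smul del Q \<longrightarrow>
       (\<forall>m\<^sub>1 m\<^sub>2. let B = AKNS_projection Q in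
          coeffwise (del m\<^sub>1) (B m\<^sub>2) - coeffwise (del m\<^sub>2) (B m\<^sub>1) - bracket (B m\<^sub>1) (B m\<^sub>2) = 0))
  \<and> (\<forall>(smul :: complex \<Rightarrow> 'r \<Rightarrow> 'r) del Z.
       strict_AKNS_setting smul del \<longrightarrow> strict_AKNS_solution smul del Z \<longrightarrow>
       (\<forall>m\<^sub>1\<ge>1. \<forall>m\<^sub>2\<ge>1. let C = strict_AKNS_projection Z in
          coeffwise (del m\<^sub>1) (C m\<^sub>2) - coeffwise (del m\<^sub>2) (C m\<^sub>1) - bracket (C m\<^sub>1) (C m\<^sub>2) = 0))"
proof (intro conjI allI impI)
  fix smul :: "complex \<Rightarrow> 'r \<Rightarrow> 'r" and del Q m\<^sub>1 m\<^sub>2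
  assume "AKNS_setting smul del" and Q: "AKNS_solution smul del Q"
  then have "del m 0 = 0" for m
    by (auto simp: AKNS_setting_def intro: commuting_derivations_0)
  with Q show "let B = AKNS_projection Q in
      coeffwise (del m\<^sub>1) (B m\<^sub>2) - coeffwise (del m\<^sub>2) (B m\<^sub>1) - bracket (B m\<^sub>1) (B m\<^sub>2) = 0"
    unfolding Let_def
    by (intro zero_curvature[of 0]) (auto simp: AKNS_solution_def AKNS_projection_def)
next
  fix smul :: "complex \<Rightarrow> 'r \<Rightarrow> 'r" and del Z and m\<^sub>1 m\<^sub>2 :: nat
  assume "strict_AKNS_setting smul del" and Z: "strict_AKNS_solution smul del Z"
    and m: "1 \<le> m\<^sub>1" "1 \<le> m\<^sub>2"
  then have "del m\<^sub>1 0 = 0" "del m\<^sub>2 0 = 0"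
    by (auto simp: strict_AKNS_setting_def intro: commuting_derivations_0)
  with Z m show "let C = strict_AKNS_projection Z in
      coeffwise (del m\<^sub>1) (C m\<^sub>2) - coeffwise (del m\<^sub>2) (C m\<^sub>1) - bracket (C m\<^sub>1) (C m\<^sub>2) = 0"
    unfolding Let_def
    \<comment> \<open>The exponents of the lemma become \<open>m\<^sub>1 - 1\<close> and
      \<open>m\<^sub>2 - 1\<close>; the bounds in \<open>m\<close> make the Lax equations
      available.\<close>
    by (intro zero_curvature[of 1])
      (auto simp: strict_AKNS_solution_def strict_AKNS_projection_def)
qed

end
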